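(* Let $I$ be a nondegenerate compact interval of real numbers, and let $\prec$ denote the Sharkovsky ordering of the positive integers. The following three statements hold: (1) Assume that $f : I \to I$ is a continuous map. If $f$ has a period-$m$ point and if $m \prec n$, then $f$ also has a period-$n$ point. (2) For each positive integer $n$ there exists a continuous map $f : I \to I$ that has a period-$n$ point but that has no period-$m$ point for any $m$ with $m \prec n$. (3) There exists a continuous map $f : I \to I$ that has a period-$2^i$ point for $i = 0, 1, 2, \ldots$ and has no periodic point of any other period.
   Context: For a map $f : I \to I$, $f^k$ denotes the $k$-fold composition of $f$ with itself. For a positive integer $k$, a period-$k$ point of $f$ is a point $x \in I$ with $f^k(x) = x$ and $f^j(x) \neq x$ for $1 \le j < k$ (that is, $k$ is the least period of $x$). "Period" always means least period. The Sharkovsky ordering $\prec$ is the following strict total ordering of the positive integers: $$3 \prec 5 \prec 7 \prec 9 \prec \cdots \prec 2 \cdot 3 \prec 2 \cdot 5 \prec 2 \cdot 7 \prec 2 \cdot 9 \prec \cdots \prec 2^2 \cdot 3 \prec 2^2 \cdot 5 \prec 2^2 \cdot 7 \prec 2^2 \cdot 9 \prec \cdots \prec \cdots \prec 2^3 \prec 2^2 \prec 2 \prec 1.$$ That is: first the odd integers $\ge 3$ in increasing order, then $2$ times these, then $2^2$ times these, and so on for $2^k$ with $k$ increasing, and finally, after all of these, the powers of $2$ in decreasing order, ending with $1$. *)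

theory Defs
  imports "HOL-Analysis.Analysis"
begin

(* A positive integer is written as 2 ^ k * p with p odd; p = 1 gives the powers of two that come last. *)
inductive sharkovsky :: "nat \<Rightarrow> nat \<Rightarrow> bool"  (infix "\<prec>\<^sub>S" 50) where
  same_exponent: "2 ^ k * p \<prec>\<^sub>S 2 ^ k * q" if "odd p" "odd q" "3 \<le> p" "p < q"
| less_exponent: "2 ^ k * p \<prec>\<^sub>S 2 ^ l * q" if "odd p" "odd q" "3 \<le> p" "3 \<le> q" "k < l"
| before_powers: "2 ^ k * p \<prec>\<^sub>S 2 ^ l" if "odd p" "3 \<le> p"
| powers: "2 ^ k \<prec>\<^sub>S 2 ^ l" if "l < k"

definition period_point :: "'a set \<Rightarrow> ('a \<Rightarrow> 'a) \<Rightarrow> nat \<Rightarrow> 'a \<Rightarrow> bool" where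
  "period_point I f k x \<longleftrightarrow>
     0 < k \<and> x \<in> I \<and> (f ^^ k) x = x \<and> (\<forall>j. 1 \<le> j \<and> j < k \<longrightarrow> (f ^^ j) x \<noteq> x)"

(* Only the values of f on I matter; f is total because HOL functions are. *)
definition continuous_self_map :: "'a::topological_space set \<Rightarrow> ('a \<Rightarrow> 'a) \<Rightarrow> bool" where
  "continuous_self_map I f \<longleftrightarrow> continuous_on I f \<and> f ` I \<subseteq> I"

end

theory Submission
  imports Defs
begin

text \<open>
  The forcing part needs no itineraries of general coverings; the arguments of
  Bau-Sen Du reduce it to three steps. From a cycle of length at least 3 one extracts a point \<open>v\<close>
  and a fixed point \<open>z\<close> with \<open>f (f v) < v < z < f v\<close> such that \<open>f v\<close> lies on the cycle
  (\<open>turning_point\<close>). Just to the left of \<open>v\<close> there is a last point \<open>y\<close> fixed by the square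
  of \<open>f\<close>, and \<open>f y\<close> is at least \<open>z\<close> (\<open>last_two_cycle_point\<close>). This yields three facts.

  \<^item> The point \<open>y\<close> has period 2 (\<open>period_two\<close>).

  \<^item> If the length \<open>m\<close> of the cycle is odd, the graph of the iterate of order \<open>m + 2\<close> lies above
    the diagonal at \<open>y\<close> and below it at \<open>v\<close>. The fixed point of this iterate that is nearest to
    \<open>y\<close> has least period \<open>m + 2\<close>: a smaller, necessarily odd, period could be raised by
    2 repeatedly while the point moves closer to \<open>y\<close> (\<open>odd_period_add_two\<close>).

  \<^item> If \<open>m\<close> is odd, no interval left of \<open>z\<close> that contains \<open>v\<close> is invariant under the square
    of \<open>f\<close>, since the orbit of \<open>v\<close> under the square reaches \<open>f v > z\<close>. Hence the
    square has a horseshoe left of \<open>z\<close>, on which \<open>f\<close> itself is at least \<open>z\<close>; its periodic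
    points of period \<open>n\<close> have period \<open>2 * n\<close> under \<open>f\<close> (\<open>odd_period_forces_even\<close>).

  Applying these to the iterates of \<open>f\<close> of order a power of two, and translating periods of iterates into periods
  of \<open>f\<close>, gives the whole ordering (\<open>sharkovsky_forcing\<close>).

  The examples are tent maps cut off at a height \<open>h\<close>. A cycle of the tent map survives the cut
  exactly when its largest point, its peak, is at most \<open>h\<close>, and the only new cycle is the one
  through \<open>h\<close>. Cutting at the peak of a cycle of length \<open>m\<close> and applying the forcing theorem shows that
  every \<open>n\<close> forced by \<open>m\<close> occurs with a strictly lower peak (\<open>peak_decreasing\<close>). So a cut at the
  lowest peak of period \<open>n\<close> keeps \<open>n\<close> but none of the periods that force it, and a cut at the supremum of
  the lowest peaks of the powers of two keeps precisely the powers of two.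
\<close>

section \<open>Iterates and least periods\<close>

lemma funpow_mem: "f ` I \<subseteq> I \<Longrightarrow> x \<in> I \<Longrightarrow> (f ^^ n) x \<in> I"
  by (induction n) auto

lemma continuous_self_map_funpow:
  assumes "continuous_self_map I f"
  shows "continuous_self_map I (f ^^ n)"
proof (induction n)
  case 0
  then show ?case by (simp add: continuous_self_map_def id_def)
next
  case (Suc n)
  have "continuous_on I (f \<circ> (f ^^ n))"
    using Suc assms unfolding continuous_self_map_def
    by (intro continuous_on_compose) (auto intro: continuous_on_subset)
  then show ?case
    using Suc assms unfolding continuous_self_map_def by auto
qed

lemma funpow_fixed: "f x = x \<Longrightarrow> (f ^^ n) x = x"
  by (induction n) auto

lemma funpow_two: "(f ^^ 2) x = f (f x)"
  by (simp add: numeral_2_eq_2)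

text \<open>This form turns all questions about periods of iterates into divisibility.\<close>

lemma period_point_iff_dvd:
  "period_point I f k x \<longleftrightarrow> 0 < k \<and> x \<in> I \<and> (\<forall>n. (f ^^ n) x = x \<longleftrightarrow> k dvd n)"
proof
  assume P: "period_point I f k x"
  have "(f ^^ n) x = x \<longleftrightarrow> k dvd n" for n
  proof -
    have k: "0 < k" "(f ^^ k) x = x" using P by (auto simp: period_point_def)
    have e: "(f ^^ (n mod k)) x = (f ^^ n) x" by (rule funpow_mod_eq[OF k(2)])
    have lt: "n mod k < k" using k by simp
    have "(f ^^ (n mod k)) x = x \<longleftrightarrow> n mod k = 0"
    proof
      assume "(f ^^ (n mod k)) x = x"
      then show "n mod k = 0"
        using P lt unfolding period_point_def by (metis One_nat_def Suc_leI neq0_conv)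
    qed simp
    then show ?thesis by (simp add: e mod_eq_0_iff_dvd)
  qed
  then show "0 < k \<and> x \<in> I \<and> (\<forall>n. (f ^^ n) x = x \<longleftrightarrow> k dvd n)"
    using P by (auto simp: period_point_def)
next
  assume "0 < k \<and> x \<in> I \<and> (\<forall>n. (f ^^ n) x = x \<longleftrightarrow> k dvd n)"
  then show "period_point I f k x"
    by (auto simp: period_point_def dest: dvd_imp_le)
qed

lemma period_point_unique:
  "period_point I f m x \<Longrightarrow> period_point I f n x \<Longrightarrow> m = n"
  by (meson dvd_antisym dvd_refl period_point_iff_dvd)

lemma period_point_exists:
  assumes "x \<in> I" "0 < n" "(f ^^ n) x = x"
  obtains k where "period_point I f k x" "k dvd n"
proof -
  define k where "k = (LEAST k. 0 < k \<and> (f ^^ k) x = x)"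
  have k: "0 < k \<and> (f ^^ k) x = x"
    unfolding k_def by (rule LeastI[of _ n]) (use assms in auto)
  have "(f ^^ j) x \<noteq> x" if "1 \<le> j" "j < k" for j
    using not_less_Least[of j "\<lambda>k. 0 < k \<and> (f ^^ k) x = x"] that unfolding k_def by auto
  then have P: "period_point I f k x"
    using k assms by (auto simp: period_point_def)
  with assms that show ?thesis by (auto simp: period_point_iff_dvd)
qed

text \<open>A cycle can be run backwards by running it forwards, so no point of it returns earlier
  than another.\<close>

lemma period_point_funpow:
  assumes P: "period_point I f k x" and "f ` I \<subseteq> I"
  shows "period_point I f k ((f ^^ j) x)"
proof -
  have return: "(f ^^ ((k - 1) * j)) ((f ^^ j) x) = x"
  proof -
    have "(k - 1) * j + j = k * j"
      using P by (cases k) (auto simp: period_point_def)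
    then have "(f ^^ ((k - 1) * j)) ((f ^^ j) x) = (f ^^ (k * j)) x"
      by (metis comp_apply funpow_add)
    also have "\<dots> = x" using P by (auto simp: period_point_iff_dvd)
    finally show ?thesis .
  qed
  have "(f ^^ n) ((f ^^ j) x) = (f ^^ j) x \<longleftrightarrow> (f ^^ n) x = x" for n
  proof
    assume "(f ^^ n) x = x"
    then show "(f ^^ n) ((f ^^ j) x) = (f ^^ j) x"
      by (metis add.commute comp_apply funpow_add)
  next
    assume e: "(f ^^ n) ((f ^^ j) x) = (f ^^ j) x"
    have "(f ^^ n) x = (f ^^ n) ((f ^^ ((k - 1) * j)) ((f ^^ j) x))" by (simp only: return)
    also have "\<dots> = (f ^^ ((k - 1) * j)) ((f ^^ n) ((f ^^ j) x))"
      by (metis add.commute comp_apply funpow_add)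
    finally show "(f ^^ n) x = x" by (simp only: e return)
  qed
  then show ?thesis
    using P funpow_mem[OF assms(2)] by (auto simp: period_point_iff_dvd)
qed

lemma finite_orbit:
  assumes "period_point I f n x"
  shows "finite (range (\<lambda>j. (f ^^ j) x))"
proof -
  have n: "0 < n" "(f ^^ n) x = x" using assms by (auto simp: period_point_def)
  have "(f ^^ j) x = (f ^^ (j mod n)) x" for j
    by (rule funpow_mod_eq[OF n(2), symmetric])
  moreover have "j mod n < n" for j using n by simp
  ultimately have "range (\<lambda>j. (f ^^ j) x) \<subseteq> (\<lambda>j. (f ^^ j) x) ` {..<n}" by blast
  then show ?thesis by (rule finite_subset) simp
qed

lemma period_point_of_power:
  assumes "period_point I f (s * p) x"
  shows "period_point I (f ^^ s) p x"
  using assms unfolding period_point_iff_dvd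
  by (auto simp: funpow_mult mult.commute)

text \<open>With \<open>r\<close> the period under \<open>f\<close>, the iterates of the power that fix \<open>x\<close> are the \<open>n\<close>
  with \<open>r\<close> dividing \<open>s * n\<close>; cancelling the greatest common divisor leaves the multiples
  of \<open>r\<close> divided by that divisor.\<close>

lemma period_point_from_power:
  assumes P: "period_point I (f ^^ s) p x" and s: "0 < s"
  obtains r where "period_point I f r x" "r = gcd r s * p"
proof -
  have p: "0 < p" "x \<in> I" and dv: "\<And>n. (f ^^ (s * n)) x = x \<longleftrightarrow> p dvd n"
    using P by (auto simp: period_point_iff_dvd funpow_mult mult.commute)
  obtain r where r: "period_point I f r x"
    using period_point_exists[where x = x and I = I and n = "s * p" and f = f] p dv s by auto
  have r0: "0 < r" using r by (simp add: period_point_def)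
  define g where "g = gcd r s"
  have g0: "0 < g" using r0 by (simp add: g_def)
  obtain r' s' where rs: "r = r' * g" "s = s' * g" "coprime r' s'"
    using gcd_coprime_exists[of r s] g0 unfolding g_def by auto
  have "p dvd n \<longleftrightarrow> r' dvd n" for n
  proof -
    have "p dvd n \<longleftrightarrow> r dvd s * n"
      using dv r by (auto simp: period_point_iff_dvd)
    also have "\<dots> \<longleftrightarrow> g * r' dvd g * (s' * n)" by (simp add: rs ac_simps)
    also have "\<dots> \<longleftrightarrow> r' dvd s' * n" using g0 by simp
    also have "\<dots> \<longleftrightarrow> r' dvd n" using rs(3) by (simp add: coprime_dvd_mult_right_iff)
    finally show ?thesis .
  qed
  then have "p = r'" by (meson dvd_antisym dvd_refl)
  then have "r = gcd r s * p" using rs(1) by (simp add: g_def mult.commute)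
  with r that show ?thesis by blast
qed

lemma period_from_power_of_two:
  assumes "period_point I (f ^^ (2 ^ k)) p x"
  obtains i where "i \<le> k" "period_point I f (2 ^ i * p) x"
proof -
  obtain r where r: "period_point I f r x" "r = gcd r (2 ^ k) * p"
    using period_point_from_power[OF assms] by auto
  have "gcd r (2 ^ k) dvd 2 ^ k" by simp
  then obtain i where "i \<le> k" "gcd r (2 ^ k) = 2 ^ i"
    using divides_primepow_nat[of 2] two_is_prime_nat by auto
  with r that show ?thesis by auto
qed

text \<open>An even period leaves no choice for the exponent: if the common divisor were a smaller power
  of two, the factor 2 of the period would enlarge it.\<close>

lemma even_period_from_power_of_two:
  assumes "period_point I (f ^^ (2 ^ k)) (2 * q) x"
  shows "period_point I f (2 ^ k * (2 * q)) x"
proof -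
  obtain r where r: "period_point I f r x" "r = gcd r (2 ^ k) * (2 * q)"
    using period_point_from_power[OF assms] by auto
  have "gcd r (2 ^ k) dvd 2 ^ k" by simp
  then obtain i where i: "i \<le> k" "gcd r (2 ^ k) = 2 ^ i"
    using divides_primepow_nat[of 2] two_is_prime_nat by auto
  have "i = k"
  proof (rule ccontr)
    assume "i \<noteq> k"
    then have "(2::nat) ^ Suc i dvd 2 ^ k" using i by (intro le_imp_power_dvd) auto
    moreover have "2 ^ Suc i dvd r"
      by (subst r(2)) (simp add: i)
    ultimately have "2 ^ Suc i dvd gcd r (2 ^ k)" by simp
    then show False by (simp add: i(2))
  qed
  with r i show ?thesis by simp
qed

section \<open>Extremal zeros of a continuous function\<close>

lemma last_zero:
  fixes h :: "real \<Rightarrow> real"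
  assumes cont: "continuous_on {c..d} h" and "c \<le> d" "0 \<le> h c" "h d < 0"
  obtains y where "c \<le> y" "y < d" "h y = 0" "\<And>x. y < x \<Longrightarrow> x \<le> d \<Longrightarrow> h x < 0"
proof -
  define S where "S = {c..d} \<inter> h -` {0..}"
  have "closed S" unfolding S_def
    by (rule continuous_closed_preimage[OF cont]) auto
  moreover have "bounded S" unfolding S_def by (rule bounded_subset[of "{c..d}"]) auto
  ultimately have "compact S" by (simp add: compact_eq_bounded_closed)
  moreover have "c \<in> S" using assms by (simp add: S_def)
  ultimately obtain y where y: "y \<in> S" "\<And>x. x \<in> S \<Longrightarrow> x \<le> y"
    using compact_attains_sup[of S] by auto
  have yy: "c \<le> y" "y \<le> d" "0 \<le> h y" using y(1) by (auto simp: S_def)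
  have neg: "h x < 0" if "y < x" "x \<le> d" for x
    using y(2)[of x] that yy by (auto simp: S_def not_less[symmetric])
  have "\<exists>x\<ge>y. x \<le> d \<and> h x = 0"
    using IVT2'[of h d 0 y] yy assms continuous_on_subset[OF cont, of "{y..d}"] by auto
  then have "h y = 0" using neg by (metis less_eq_real_def less_irrefl)
  moreover have "y < d" using yy assms by (cases "y = d") auto
  ultimately show ?thesis using that yy neg by blast
qed

lemma first_zero:
  fixes h :: "real \<Rightarrow> real"
  assumes cont: "continuous_on {c..d} h" and "c \<le> d" "h c < 0" "0 \<le> h d"
  obtains y where "c < y" "y \<le> d" "h y = 0" "\<And>x. c \<le> x \<Longrightarrow> x < y \<Longrightarrow> h x < 0"
proof -
  have "continuous_on {-d..-c} (\<lambda>x. h (- x))"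
    by (rule continuous_on_compose2[OF cont]) (auto intro: continuous_intros)
  then obtain y where y: "-d \<le> y" "y < -c" "h (- y) = 0"
      "\<And>x. y < x \<Longrightarrow> x \<le> -c \<Longrightarrow> h (- x) < 0"
    using last_zero[of "-d" "-c" "\<lambda>x. h (- x)"] assms by auto
  have "h x < 0" if "c \<le> x" "x < - y" for x
    using y(4)[of "- x"] that by auto
  with that[of "- y"] y show ?thesis by auto
qed

section \<open>A turning point next to a cycle\<close>

text \<open>Take \<open>p\<close> the least point of the cycle, \<open>q\<close> its preimage on the cycle, and \<open>z\<close> the last fixed
  point between them. If \<open>f\<close> stayed below \<open>q\<close> on \<open>{p..z}\<close>, it would do so on \<open>{p..q}\<close>, and
  the cycle could never climb from \<open>p\<close> to \<open>q\<close>. So some \<open>v\<close> left of \<open>z\<close> is mapped to \<open>q\<close>, and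
  from there to \<open>p\<close>. The choice of the least point avoids a mirror-image case.\<close>

lemma turning_point:
  fixes f :: "real \<Rightarrow> real"
  assumes csm: "continuous_self_map {a..b} f" and P: "period_point {a..b} f m x0" and m: "3 \<le> m"
  obtains v z where "a \<le> v" "z \<le> b" "f z = z" "v < z" "z < f v" "f (f v) < v"
    "period_point {a..b} f m (f v)"
proof -
  have maps: "f ` {a..b} \<subseteq> {a..b}" and cont: "continuous_on {a..b} f"
    using csm by (auto simp: continuous_self_map_def)
  define Orb where "Orb = range (\<lambda>j. (f ^^ j) x0)"
  have Orb_per: "period_point {a..b} f m y" if "y \<in> Orb" for y
    using that period_point_funpow[OF P maps] by (auto simp: Orb_def)
  have Orb_step: "(f ^^ j) y \<in> Orb" if "y \<in> Orb" for y j
    using that unfolding Orb_def by (auto simp: image_iff) (metis comp_apply funpow_add)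
  have fin: "finite Orb" and ne: "Orb \<noteq> {}"
    using finite_orbit[OF P] by (auto simp: Orb_def)
  define p where "p = Min Orb"
  have pO: "p \<in> Orb" using fin ne by (simp add: p_def)
  have p_min: "p \<le> y" if "y \<in> Orb" for y using fin that by (simp add: p_def)
  have Pp: "period_point {a..b} f m p" using Orb_per pO by blast
  define q where "q = (f ^^ (m - 1)) p"
  have qO: "q \<in> Orb" using Orb_step pO by (simp add: q_def)
  have "f q = (f ^^ m) p" using m unfolding q_def by (cases m) auto
  then have fq: "f q = p" using Pp by (simp add: period_point_def)
  have qp: "q \<noteq> p" using Pp m unfolding q_def period_point_def by auto
  have pq: "p < q" using qp p_min[OF qO] by simp
  have "f p \<noteq> p" using Pp m unfolding period_point_def by (auto dest!: spec[of _ 1])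
  moreover have "f p \<in> Orb" using Orb_step[OF pO, of 1] by simp
  ultimately have fp: "p < f p" using p_min by (metis less_eq_real_def)
  have pI: "a \<le> p" and qI: "q \<le> b"
    using Orb_per[OF pO] Orb_per[OF qO] by (auto simp: period_point_def)
  have contpq: "continuous_on {p..q} f"
    using cont by (rule continuous_on_subset) (use pI qI in auto)
  have "continuous_on {p..q} (\<lambda>x. f x - x)"
    by (intro continuous_intros contpq)
  then obtain z where z: "p \<le> z" "z < q" "f z - z = 0" "\<And>x. z < x \<Longrightarrow> x \<le> q \<Longrightarrow> f x - x < 0"
    by (rule last_zero) (use pq fp fq in auto)
  have "\<exists>w. p \<le> w \<and> w \<le> z \<and> q \<le> f w"
  proof (rule ccontr)
    assume "\<not> ?thesis"
    then have A: "\<And>w. p \<le> w \<Longrightarrow> w \<le> z \<Longrightarrow> f w < q" by force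
    have "(f ^^ j) p < q" for j
    proof (induction j)
      case 0 then show ?case using pq by simp
    next
      case (Suc j)
      have "p \<le> (f ^^ j) p" using p_min Orb_step pO by blast
      then show ?case
        using A[of "(f ^^ j) p"] z(4)[of "(f ^^ j) p"] Suc by (cases "(f ^^ j) p \<le> z") auto
    qed
    then show False unfolding q_def by blast
  qed
  then obtain w where w: "p \<le> w" "w \<le> z" "q \<le> f w" by blast
  have "\<exists>v\<ge>w. v \<le> z \<and> f v = q"
    using IVT2'[of f z q w] w z continuous_on_subset[OF contpq, of "{w..z}"] by auto
  then obtain v where v: "w \<le> v" "v \<le> z" "f v = q" by blast
  have "v \<noteq> p"
  proof
    assume "v = p"
    then have "(f ^^ 2) p = p" using v fq by (simp add: funpow_two)
    then show False using Pp m unfolding period_point_def by auto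
  qed
  moreover have "v \<noteq> z" using v z by auto
  ultimately show ?thesis
    using that[of v z] v w z pI qI fq Orb_per[OF qO] by auto
qed

text \<open>The square of \<open>f\<close> lies above the diagonal at \<open>a\<close> and below it at \<open>v\<close>. Between the last crossing
  \<open>y\<close> and \<open>v\<close> the map \<open>f\<close> cannot take the value \<open>z\<close>, since the square would then take the
  value \<open>z\<close>, above the diagonal.\<close>

lemma last_two_cycle_point:
  fixes f :: "real \<Rightarrow> real"
  assumes csm: "continuous_self_map {a..b} f"
    and v: "a \<le> v" "z \<le> b" "f z = z" "v < z" "z < f v" "f (f v) < v"
  obtains y where "a \<le> y" "y < v" "f (f y) = y" "z \<le> f y"
    "\<And>x. y < x \<Longrightarrow> x \<le> v \<Longrightarrow> f (f x) < x"
proof -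
  have maps: "\<And>x. x \<in> {a..b} \<Longrightarrow> f x \<in> {a..b}" and cont: "continuous_on {a..b} f"
    using csm by (auto simp: continuous_self_map_def image_subset_iff)
  have "continuous_on {a..b} (f ^^ 2)"
    using continuous_self_map_funpow[OF csm] by (simp add: continuous_self_map_def)
  then have "continuous_on {a..v} (\<lambda>x. f (f x))"
    unfolding funpow_two[abs_def] by (rule continuous_on_subset) (use v in auto)
  then have "continuous_on {a..v} (\<lambda>x. f (f x) - x)" by (intro continuous_intros)
  moreover have "a \<le> f (f a)" using maps[of a] maps[of "f a"] v by auto
  ultimately obtain y where y: "a \<le> y" "y < v" "f (f y) - y = 0"
      "\<And>x. y < x \<Longrightarrow> x \<le> v \<Longrightarrow> f (f x) - x < 0"
    using v by (elim last_zero) auto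
  have "z \<le> f y"
  proof (rule ccontr)
    assume "\<not> z \<le> f y"
    then have "\<exists>x\<ge>y. x \<le> v \<and> f x = z"
      using IVT'[of f y z v] y v continuous_on_subset[OF cont, of "{y..v}"] by auto
    then obtain x where x: "y \<le> x" "x \<le> v" "f x = z" by blast
    then have "y < x" using \<open>\<not> z \<le> f y\<close> by (cases "x = y") auto
    from y(4)[OF this x(2)] show False using x v by simp
  qed
  with that[of y] y show ?thesis by auto
qed

section \<open>The three forcing steps\<close>

lemma period_two:
  fixes f :: "real \<Rightarrow> real"
  assumes csm: "continuous_self_map {a..b} f" and P: "period_point {a..b} f m x0" and m: "3 \<le> m"
  shows "\<exists>x. period_point {a..b} f 2 x"
proof -
  obtain v z where v: "a \<le> v" "z \<le> b" "f z = z" "v < z" "z < f v" "f (f v) < v"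
    by (rule turning_point[OF csm P m])
  obtain y where y: "a \<le> y" "y < v" "f (f y) = y" "z \<le> f y"
    by (rule last_two_cycle_point[OF csm v]) blast
  have "j = 1" if "1 \<le> j" "j < 2" for j :: nat using that by simp
  moreover have "f y \<noteq> y" "y \<in> {a..b}" using y v by auto
  ultimately have "period_point {a..b} f 2 y"
    unfolding period_point_def using y(3) by (fastforce simp: funpow_two)
  then show ?thesis ..
qed

text \<open>At every odd order the iterate of \<open>f\<close> sends \<open>y\<close> to \<open>f y\<close>, above the diagonal. A point \<open>x\<close> between
  \<open>y\<close> and \<open>v\<close> fixed by an odd iterate is lowered by the iterate of order two higher, which therefore
  has a fixed point strictly between \<open>y\<close> and \<open>x\<close>. Starting from a proper divisor of \<open>m + 2\<close>,
  this would lead to a fixed point of order \<open>m + 2\<close> nearer to \<open>y\<close> than the first one.\<close>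

lemma odd_period_add_two:
  fixes f :: "real \<Rightarrow> real"
  assumes csm: "continuous_self_map {a..b} f" and P: "period_point {a..b} f m x0"
    and m: "3 \<le> m" "odd m"
  shows "\<exists>x. period_point {a..b} f (m + 2) x"
proof -
  obtain v z where v: "a \<le> v" "z \<le> b" "f z = z" "v < z" "z < f v" "f (f v) < v"
    and Pv: "period_point {a..b} f m (f v)"
    by (rule turning_point[OF csm P m(1)])
  obtain y where y: "a \<le> y" "y < v" "f (f y) = y" "z \<le> f y"
    and below: "\<And>x. y < x \<Longrightarrow> x \<le> v \<Longrightarrow> f (f x) < x"
    by (rule last_two_cycle_point[OF csm v]) blast
  have cont: "continuous_on {y..x} (f ^^ n)" if "x \<le> v" for n x
    using continuous_self_map_funpow[OF csm, of n] y v that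
    by (auto simp: continuous_self_map_def intro: continuous_on_subset)
  have odd_y: "y < (f ^^ n) y" if "odd n" for n
  proof -
    obtain k where k: "n = 1 + 2 * k" using \<open>odd n\<close> by (auto elim: oddE)
    have "(f ^^ (2 * k)) y = y"
      using funpow_fixed[of "f ^^ 2" y k] y by (simp add: funpow_two funpow_mult mult.commute)
    then have "(f ^^ n) y = f y" by (simp add: k)
    then show ?thesis using y v by simp
  qed
  have add_two: "(f ^^ (n + 2)) x = (f ^^ n) (f (f x))" for n x
    by (simp only: funpow_add comp_apply funpow_two)
  have step: "\<exists>x'. y < x' \<and> x' < x \<and> (f ^^ (n + 2)) x' = x'"
    if x: "y < x" "x \<le> v" "(f ^^ n) x = x" and n: "odd n" for x n
  proof -
    have "(f ^^ (n + 2)) x = f (f ((f ^^ n) x))"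
      by simp
    then have lt: "(f ^^ (n + 2)) x < x" using below[OF x(1,2)] x by simp
    have gt: "y < (f ^^ (n + 2)) y" using odd_y[of "n + 2"] n by simp
    have "continuous_on {y..x} (\<lambda>t. t - (f ^^ (n + 2)) t)"
      by (intro continuous_intros cont x)
    then have "\<exists>x'\<ge>y. x' \<le> x \<and> x' - (f ^^ (n + 2)) x' = 0"
      using lt gt x by (intro IVT') auto
    then obtain x' where x': "y \<le> x'" "x' \<le> x" "(f ^^ (n + 2)) x' = x'" by auto
    have "x' \<noteq> y" "x' \<noteq> x" using x' lt gt by auto
    with x' show ?thesis by force
  qed
  have "(f ^^ m) (f (f v)) = f (f v)"
    using period_point_funpow[OF Pv, of 1] csm by (simp add: period_point_def continuous_self_map_def)
  then have at_v: "(f ^^ (m + 2)) v < v" using v by (simp only: add_two)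
  have at_y: "y < (f ^^ (m + 2)) y" using odd_y[of "m + 2"] m by simp
  have zero_cont: "continuous_on {y..v} (\<lambda>t. t - (f ^^ (m + 2)) t)"
    by (intro continuous_intros cont) simp
  have ends: "y \<le> v" "y - (f ^^ (m + 2)) y < 0" "0 \<le> v - (f ^^ (m + 2)) v"
    using at_v at_y y(2) by linarith+
  obtain x where x: "y < x" "x \<le> v" "x - (f ^^ (m + 2)) x = 0"
      and first: "\<And>t. y \<le> t \<Longrightarrow> t < x \<Longrightarrow> t - (f ^^ (m + 2)) t < 0"
    by (rule first_zero[OF zero_cont ends]) blast
  obtain k where k: "period_point {a..b} f k x" "k dvd m + 2"
    using period_point_exists[where x = x and I = "{a..b}" and n = "m + 2" and f = f] x y v by auto
  have "k = m + 2"
  proof (rule ccontr)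
    assume "k \<noteq> m + 2"
    then have km: "k < m + 2" using k by (auto dest: dvd_imp_le)
    have "odd k" using k(2) m(2) by (metis dvd_trans even_add even_numeral)
    have chain: "\<exists>x'. y < x' \<and> x' < x \<and> (f ^^ (k + 2 * Suc i)) x' = x'" for i
    proof (induction i)
      case 0
      show ?case using step[of x k] x k \<open>odd k\<close> by (simp add: period_point_def)
    next
      case (Suc i)
      then obtain x' where x': "y < x'" "x' < x" "(f ^^ (k + 2 * Suc i)) x' = x'" by blast
      from step[of x' "k + 2 * Suc i"] x' x \<open>odd k\<close>
      obtain x'' where "y < x''" "x'' < x'" "(f ^^ (k + 2 * Suc i + 2)) x'' = x''" by auto
      moreover have "k + 2 * Suc i + 2 = k + 2 * Suc (Suc i)" by simp
      ultimately show ?case using x' by (metis less_trans)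
    qed
    have "even (m + 2 - k)" using \<open>odd k\<close> m km by simp
    then obtain j where j: "m + 2 - k = 2 * j" by (rule evenE)
    with km have "j \<noteq> 0" by (intro notI) simp
    then obtain i where "j = Suc i" by (auto simp: gr0_conv_Suc)
    with j km have "m + 2 = k + 2 * Suc i" by simp
    with chain[of i] obtain x' where "y < x'" "x' < x" "(f ^^ (m + 2)) x' = x'" by auto
    with first[of x'] show False by simp
  qed
  with k show ?thesis by blast
qed

text \<open>The periodic orbit visits \<open>{d..u}\<close> once and spends the rest of its cycle in \<open>{u..e}\<close>. The bound
  by \<open>e\<close> makes this easy to arrange: pulling \<open>d\<close> back along the right branch, always to the last
  preimage, gives points \<open>w\<close> such that everything in \<open>{w..e}\<close> stays in \<open>{u..e}\<close> for \<open>k\<close> steps.\<close>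

lemma horseshoe_period_point:
  fixes g :: "real \<Rightarrow> real"
  assumes csm: "continuous_self_map I g" and sub: "{d..e} \<subseteq> I"
    and due: "d < u" "u < e" and g: "g d = e" "g u = d" "g e = e"
    and le: "\<And>x. d \<le> x \<Longrightarrow> x \<le> e \<Longrightarrow> g x \<le> e"
    and n: "0 < n"
  obtains x where "d \<le> x" "x \<le> u" "period_point I g n x" "\<And>i. (g ^^ i) x \<in> {d..e}"
proof -
  have cont: "continuous_on {s..t} (g ^^ i)" if "d \<le> s" "t \<le> e" for s t i
    using continuous_self_map_funpow[OF csm, of i] sub that
    unfolding continuous_self_map_def by (meson atLeastatMost_subset_iff continuous_on_subset order_trans)
  have cont1: "continuous_on {s..t} g" if "d \<le> s" "t \<le> e" for s t
    using cont[of s t 1] that by simp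
  have right: "\<exists>w. d \<le> w \<and> w < e \<and> (g ^^ k) w = d \<and>
      (\<forall>x i. w \<le> x \<longrightarrow> x \<le> e \<longrightarrow> i < k \<longrightarrow> u \<le> (g ^^ i) x \<and> (g ^^ i) x \<le> e)" for k
  proof (induction k)
    case 0
    show ?case using due by (intro exI[of _ d]) auto
  next
    case (Suc k)
    then obtain w where w: "d \<le> w" "w < e" "(g ^^ k) w = d"
      and stay: "\<And>x i. w \<le> x \<Longrightarrow> x \<le> e \<Longrightarrow> i < k \<Longrightarrow> u \<le> (g ^^ i) x \<and> (g ^^ i) x \<le> e"
      by blast
    have "continuous_on {u..e} (\<lambda>x. w - g x)"
      using due by (intro continuous_intros cont1) auto
    then obtain w' where w': "u \<le> w'" "w' < e" "w - g w' = 0"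
        and above: "\<And>x. w' < x \<Longrightarrow> x \<le> e \<Longrightarrow> w - g x < 0"
      using last_zero[of u e "\<lambda>x. w - g x"] due g w by auto
    have "u \<le> (g ^^ i) x \<and> (g ^^ i) x \<le> e" if "w' \<le> x" "x \<le> e" "i < Suc k" for x i
    proof (cases i)
      case 0
      then show ?thesis using that w' by simp
    next
      case (Suc j)
      have "w \<le> g x" using above[of x] w' that by (cases "x = w'") auto
      moreover have "g x \<le> e" using le that w' due by simp
      ultimately show ?thesis
        using stay[of "g x" j] that Suc by (simp add: funpow_swap1)
    qed
    moreover have "(g ^^ Suc k) w' = d"
      using w w' by (simp add: funpow_swap1)
    ultimately show ?case using w' due by (intro exI[of _ w']) auto
  qed
  obtain k where k: "n = Suc k" using n by (cases n) auto
  obtain w where w: "d \<le> w" "w < e" "(g ^^ k) w = d"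
    and stay: "\<And>x i. w \<le> x \<Longrightarrow> x \<le> e \<Longrightarrow> i < k \<Longrightarrow> u \<le> (g ^^ i) x \<and> (g ^^ i) x \<le> e"
    using right[of k] by blast
  have "continuous_on {d..u} (\<lambda>x. w - g x)"
    using due by (intro continuous_intros cont1) auto
  then obtain q where q: "d < q" "q \<le> u" "w - g q = 0"
      and above: "\<And>x. d \<le> x \<Longrightarrow> x < q \<Longrightarrow> w - g x < 0"
    using first_zero[of d u "\<lambda>x. w - g x"] due g w by auto
  have "continuous_on {d..q} (\<lambda>x. x - (g ^^ n) x)"
    using due q by (intro continuous_intros cont) auto
  moreover have "(g ^^ n) q = d" "(g ^^ n) d = e"
    using w q g by (simp_all add: k funpow_swap1 funpow_fixed)
  ultimately have "\<exists>x\<ge>d. x \<le> q \<and> x - (g ^^ n) x = 0"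
    using q due by (intro IVT') auto
  then obtain x where x: "d \<le> x" "x \<le> q" "(g ^^ n) x = x" by auto
  have "w \<le> g x" using above[of x] x q by (cases "x = q") auto
  moreover have "g x \<le> e" using le x q due by simp
  ultimately have later: "u \<le> (g ^^ j) x \<and> (g ^^ j) x \<le> e" if "1 \<le> j" "j < n" for j
    using stay[of "g x" "j - 1"] that k by (cases j) (auto simp: funpow_swap1)
  have "(g ^^ j) x \<noteq> x" if j: "1 \<le> j" "j < n" for j
  proof
    assume "(g ^^ j) x = x"
    then have "x = u" using later[OF j] x q by simp
    then show False using later[of 1] j g due by simp
  qed
  then have P: "period_point I g n x"
    using x q due sub n by (auto simp: period_point_def)
  have "(g ^^ i) x \<in> {d..e}" for i
  proof -
    have "(g ^^ i) x = (g ^^ (i mod n)) x" by (rule funpow_mod_eq[OF x(3), symmetric])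
    moreover have "i mod n < n" using n by simp
    ultimately show ?thesis
      using later[of "i mod n"] x q due by (cases "i mod n = 0") auto
  qed
  with that[of x] x q P show ?thesis by auto
qed

text \<open>The horseshoe is spanned by \<open>e\<close>, the first fixed point of the square after \<open>v\<close>; \<open>d\<close>, the last
  point before \<open>v\<close> that the square sends to \<open>e\<close>; and a point \<open>u\<close> between them that the square sends to \<open>d\<close>.
  Both \<open>d\<close> and \<open>u\<close> exist because otherwise \<open>{a..<e}\<close>, respectively \<open>{d..e}\<close>, would be
  invariant under the square.\<close>

lemma odd_period_forces_even:
  fixes f :: "real \<Rightarrow> real"
  assumes csm: "continuous_self_map {a..b} f" and P: "period_point {a..b} f m x0"
    and m: "3 \<le> m" "odd m" and n: "0 < n"
  shows "\<exists>x. period_point {a..b} f (2 * n) x"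
proof -
  have maps: "\<And>x. x \<in> {a..b} \<Longrightarrow> f x \<in> {a..b}" and cont: "continuous_on {a..b} f"
    using csm by (auto simp: continuous_self_map_def image_subset_iff)
  have csm2: "continuous_self_map {a..b} (f ^^ 2)"
    by (rule continuous_self_map_funpow[OF csm])
  then have cont2: "continuous_on {a..b} (\<lambda>x. f (f x))"
    by (simp add: continuous_self_map_def funpow_two[abs_def])
  obtain v z where v: "a \<le> v" "z \<le> b" "f z = z" "v < z" "z < f v" "f (f v) < v"
    and Pv: "period_point {a..b} f m (f v)"
    by (rule turning_point[OF csm P m(1)])
  \<comment> \<open>As the period is odd, iterating the square from \<open>v\<close> also visits the points at odd distance, such as \<open>f v\<close>.\<close>
  have no_trap: "\<exists>x\<in>S. f (f x) \<notin> S" if S: "v \<in> S" "f v \<notin> S" for S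
  proof (rule ccontr)
    assume "\<not> ?thesis"
    then have inv: "\<And>x. x \<in> S \<Longrightarrow> f (f x) \<in> S" by blast
    have iter: "((f ^^ 2) ^^ i) v \<in> S" for i
      by (induction i) (auto simp: S inv funpow_two)
    obtain i where i: "Suc m = 2 * i" using m by (metis even_Suc evenE)
    have "f v = (f ^^ Suc m) v"
      using Pv by (simp add: period_point_def funpow_swap1)
    also have "\<dots> = ((f ^^ 2) ^^ i) v" by (simp add: i funpow_mult mult.commute)
    finally show False using iter[of i] S by simp
  qed
  have "continuous_on {v..z} (\<lambda>x. f (f x) - x)"
    by (intro continuous_intros continuous_on_subset[OF cont2]) (use v in auto)
  then obtain e where e: "v < e" "e \<le> z" "f (f e) - e = 0"
      and below: "\<And>x. v \<le> x \<Longrightarrow> x < e \<Longrightarrow> f (f x) - x < 0"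
    using first_zero[of v z "\<lambda>x. f (f x) - x"] v by auto
  obtain w where w: "a \<le> w" "w \<le> v" "e \<le> f (f w)"
  proof -
    have "\<exists>x\<in>{a..<e}. f (f x) \<notin> {a..<e}"
      by (rule no_trap) (use v e in auto)
    then obtain x where x: "x \<in> {a..<e}" "f (f x) \<notin> {a..<e}" ..
    then have "e \<le> f (f x)" using maps[of x] maps[of "f x"] v e by auto
    moreover have "x \<le> v" using x below[of x] \<open>e \<le> f (f x)\<close> by force
    ultimately show ?thesis using that x by auto
  qed
  have "continuous_on {w..v} (\<lambda>x. f (f x) - e)"
    by (intro continuous_intros continuous_on_subset[OF cont2]) (use v w in auto)
  then obtain d where d: "w \<le> d" "d < v" "f (f d) - e = 0"
      and right_d: "\<And>x. d < x \<Longrightarrow> x \<le> v \<Longrightarrow> f (f x) - e < 0"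
    using last_zero[of w v "\<lambda>x. f (f x) - e"] v w e by auto
  have lt_e: "f (f x) < e" if "d < x" "x < e" for x
    using right_d[of x] below[of x] that by (cases "x \<le> v") auto
  have ge_z: "z \<le> f x" if x: "d \<le> x" "x < e" for x
  proof (rule ccontr)
    assume neg: "\<not> z \<le> f x"
    have "\<exists>t. d < t \<and> t < e \<and> f t = z"
    proof (cases "x \<le> v")
      case True
      have "\<exists>t\<ge>x. t \<le> v \<and> f t = z"
        using neg v True
        by (intro IVT' continuous_on_subset[OF cont]) (use d w x in auto)
      then obtain t where t: "x \<le> t" "t \<le> v" "f t = z" by blast
      then have "t \<noteq> x" using neg by auto
      then show ?thesis using t x e by (intro exI[of _ t]) auto
    next
      case False
      have "\<exists>t\<ge>v. t \<le> x \<and> f t = z"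
        using neg v False
        by (intro IVT2' continuous_on_subset[OF cont]) (use e x in auto)
      then obtain t where t: "v \<le> t" "t \<le> x" "f t = z" by blast
      then show ?thesis using d x by (intro exI[of _ t]) auto
    qed
    then obtain t where t: "d < t" "t < e" "f t = z" by blast
    from lt_e[OF t(1,2)] show False using t v e by simp
  qed
  have le_e: "f (f x) \<le> e" if "d \<le> x" "x \<le> e" for x
    using lt_e[of x] that d e by (cases "x = d"; cases "x = e") auto
  obtain u0 where u0: "d \<le> u0" "u0 \<le> e" "f (f u0) \<le> d"
  proof -
    have "\<exists>x\<in>{d..e}. f (f x) \<notin> {d..e}"
      by (rule no_trap) (use v d e in auto)
    then obtain x where x: "x \<in> {d..e}" "f (f x) \<notin> {d..e}" ..
    with le_e[of x] that[of x] show ?thesis by auto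
  qed
  have "\<exists>u\<ge>u0. u \<le> e \<and> f (f u) = d"
    using u0 d e
    by (intro IVT'[of "\<lambda>x. f (f x)"] continuous_on_subset[OF cont2]) (use v w in auto)
  then obtain u where u: "u0 \<le> u" "u \<le> e" "f (f u) = d" by blast
  have ude: "d < u" "u < e" using u u0 d e by (auto simp: less_le)
  have de: "{d..e} \<subseteq> {a..b}" using d w e v by auto
  obtain x where x: "d \<le> x" "x \<le> u" "period_point {a..b} (f ^^ 2) n x"
      and stay: "\<And>i. ((f ^^ 2) ^^ i) x \<in> {d..e}"
    by (rule horseshoe_period_point[OF csm2 de ude, of n])
      (use d e u n le_e in \<open>auto simp: funpow_two\<close>)
  obtain r where r: "period_point {a..b} f r x" "r = gcd r 2 * n"
    using period_point_from_power[OF x(3)] by auto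
  \<comment> \<open>An odd period would put \<open>f x\<close> into the orbit under the square, hence make it at most \<open>e\<close>; being at least \<open>z\<close>, it would be the fixed point \<open>z\<close>, from which \<open>x\<close> is not reached again.\<close>
  have "even r"
  proof (rule ccontr)
    assume "odd r"
    then obtain i where i: "Suc r = 2 * i" by (metis even_Suc evenE)
    have "f x = (f ^^ Suc r) x" using r by (simp add: period_point_def)
    also have "\<dots> = ((f ^^ 2) ^^ i) x" by (simp add: i funpow_mult mult.commute)
    finally have "f x \<le> e" using stay[of i] by simp
    then have fx: "f x = z" using ge_z[of x] x ude e by simp
    obtain r' where "r = Suc r'" using r by (cases r) (auto simp: period_point_def)
    then have "(f ^^ r) x = z" using fx v by (simp add: funpow_swap1 funpow_fixed)
    then show False using r x ude e by (simp add: period_point_def)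
  qed
  then have "gcd r 2 = 2" by (simp add: gcd_nat.absorb2)
  with r have "period_point {a..b} f (2 * n) x" by simp
  then show ?thesis ..
qed

section \<open>The forcing relation\<close>

lemma fixed_point_exists:
  fixes f :: "real \<Rightarrow> real"
  assumes csm: "continuous_self_map {a..b} f" and ab: "a \<le> b"
  shows "\<exists>x. period_point {a..b} f 1 x"
proof -
  have maps: "\<And>x. x \<in> {a..b} \<Longrightarrow> f x \<in> {a..b}" and cont: "continuous_on {a..b} f"
    using csm by (auto simp: continuous_self_map_def image_subset_iff)
  have "\<exists>x\<ge>a. x \<le> b \<and> x - f x = 0"
    using maps[of a] maps[of b] ab by (intro IVT' continuous_intros cont) auto
  then show ?thesis by (auto simp: period_point_def)
qed

lemma odd_period_larger_odd:
  fixes f :: "real \<Rightarrow> real"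
  assumes csm: "continuous_self_map {a..b} f" and P: "\<exists>x. period_point {a..b} f p x"
    and p: "3 \<le> p" "odd p"
  shows "\<exists>x. period_point {a..b} f (p + 2 * i) x"
proof (induction i)
  case 0
  then show ?case using P by simp
next
  case (Suc i)
  then obtain x where "period_point {a..b} f (p + 2 * i) x" by blast
  moreover have "3 \<le> p + 2 * i" "odd (p + 2 * i)" using p by auto
  ultimately have "\<exists>x. period_point {a..b} f (p + 2 * i + 2) x"
    by (rule odd_period_add_two[OF csm])
  moreover have "p + 2 * i + 2 = p + 2 * Suc i" by simp
  ultimately show ?case by metis
qed

lemma period_multiple_of_odd_forces_even:
  fixes f :: "real \<Rightarrow> real"
  assumes csm: "continuous_self_map {a..b} f" and P: "period_point {a..b} f (2 ^ k * p) x0"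
    and p: "3 \<le> p" "odd p" and "0 < n"
  shows "\<exists>x. period_point {a..b} f (2 ^ k * (2 * n)) x"
proof -
  have "\<exists>x. period_point {a..b} (f ^^ (2 ^ k)) (2 * n) x"
    by (rule odd_period_forces_even[OF continuous_self_map_funpow[OF csm]
          period_point_of_power[OF P] p \<open>0 < n\<close>])
  then obtain x where "period_point {a..b} (f ^^ (2 ^ k)) (2 * n) x" ..
  then have "period_point {a..b} f (2 ^ k * (2 * n)) x" by (rule even_period_from_power_of_two)
  then show ?thesis ..
qed

lemma smaller_power_of_two_forced:
  fixes f :: "real \<Rightarrow> real"
  assumes csm: "continuous_self_map {a..b} f" and P: "period_point {a..b} f (2 ^ k) x0"
    and "l < k"
  shows "\<exists>x. period_point {a..b} f (2 ^ l) x"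
proof (cases l)
  case 0
  have "a \<le> b" using P by (auto simp: period_point_def)
  from fixed_point_exists[OF csm this] show ?thesis by (simp add: 0)
next
  case (Suc j)
  have "(2::nat) ^ k = 2 ^ j * 2 ^ (k - j)"
    using \<open>l < k\<close> Suc by (simp flip: power_add)
  then have Q: "period_point {a..b} (f ^^ (2 ^ j)) (2 ^ (k - j)) x0"
    using P by (intro period_point_of_power) simp
  have "(2::nat) ^ 2 \<le> 2 ^ (k - j)"
    using \<open>l < k\<close> Suc by (intro power_increasing) auto
  then have "3 \<le> (2::nat) ^ (k - j)" by simp
  then obtain x where "period_point {a..b} (f ^^ (2 ^ j)) (2 * 1) x"
    using period_two[OF continuous_self_map_funpow[OF csm] Q] by auto
  from even_period_from_power_of_two[OF this]
  have "period_point {a..b} f (2 ^ l) x" by (simp add: Suc mult.commute)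
  then show ?thesis ..
qed

lemma power_of_two_split:
  assumes "i < k"
  shows "2 ^ k * (q::nat) = 2 ^ i * (2 * (2 ^ (k - i - 1) * q))"
proof -
  obtain d where "k = i + Suc d" using less_imp_Suc_add[OF assms] by auto
  then show ?thesis by (simp add: power_add)
qed

text \<open>Raising an odd factor from \<open>p\<close> to \<open>q\<close> happens under the iterate of order \<open>2 ^ k\<close>, and going back
  to \<open>f\<close> may lose some factors of two. The step from odd to even periods restores them. The same step
  reaches every larger exponent and every large power of two, from which the smaller powers follow.\<close>

theorem sharkovsky_forcing:
  fixes f :: "real \<Rightarrow> real"
  assumes "m \<prec>\<^sub>S n" and csm: "continuous_self_map {a..b} f" and P: "\<exists>x. period_point {a..b} f m x"
  shows "\<exists>x. period_point {a..b} f n x"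
  using assms(1)
proof cases
  case (same_exponent p q k)
  obtain x where "period_point {a..b} f (2 ^ k * p) x" using P same_exponent(1) by blast
  from period_point_of_power[OF this]
  have E: "\<exists>x. period_point {a..b} (f ^^ (2 ^ k)) p x" ..
  have "even (q - p)" using same_exponent(3,4) by simp
  then obtain t where "q - p = 2 * t" by (rule evenE)
  then have q: "q = p + 2 * t" using same_exponent(6) by simp
  obtain y where "period_point {a..b} (f ^^ (2 ^ k)) q y"
    using odd_period_larger_odd[OF continuous_self_map_funpow[OF csm] E same_exponent(5,3), of t]
    unfolding q by blast
  then obtain i where i: "i \<le> k" "period_point {a..b} f (2 ^ i * q) y"
    by (rule period_from_power_of_two)
  show ?thesis
  proof (cases "i = k")
    case True
    with i(2) show ?thesis unfolding same_exponent(2) by blast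
  next
    case False
    then have ik: "i < k" using i(1) by simp
    have "3 \<le> q" "0 < 2 ^ (k - i - 1) * q" using same_exponent(5,6) by simp_all
    then show ?thesis
      unfolding same_exponent(2) power_of_two_split[OF ik]
      by (intro period_multiple_of_odd_forces_even[OF csm i(2)] same_exponent(4))
  qed
next
  case (less_exponent p q k l)
  obtain x where x: "period_point {a..b} f (2 ^ k * p) x" using P less_exponent(1) by blast
  have "0 < 2 ^ (l - k - 1) * q" using less_exponent(6) by simp
  then show ?thesis
    unfolding less_exponent(2) power_of_two_split[OF less_exponent(7)]
    by (intro period_multiple_of_odd_forces_even[OF csm x] less_exponent(3,5))
next
  case (before_powers p k l)
  obtain x where x: "period_point {a..b} f (2 ^ k * p) x" using P before_powers(1) by blast
  \<comment> \<open>The exponent is pushed beyond \<open>l\<close>, whatever the size of \<open>k\<close>, and then lowered to \<open>l\<close>.\<close>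
  have "\<exists>y. period_point {a..b} f (2 ^ k * (2 * 2 ^ l)) y"
    by (intro period_multiple_of_odd_forces_even[OF csm x] before_powers(3,4)) simp
  moreover have "(2::nat) ^ k * (2 * 2 ^ l) = 2 ^ (k + l + 1)" by (simp add: power_add)
  ultimately obtain y where "period_point {a..b} f (2 ^ (k + l + 1)) y" by metis
  from smaller_power_of_two_forced[OF csm this, of l] show ?thesis
    unfolding before_powers(2) by simp
next
  case (powers l k)
  obtain x where "period_point {a..b} f (2 ^ k) x" using P powers(1) by blast
  from smaller_power_of_two_forced[OF csm this powers(3)] show ?thesis
    unfolding powers(2) .
qed

text \<open>Irreflexivity is what later excludes that two cycles of the periods \<open>m\<close> and \<open>n\<close> coincide.\<close>

lemma sharkovsky_irrefl: "m \<prec>\<^sub>S n \<Longrightarrow> m \<noteq> n"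
proof (induction rule: sharkovsky.induct)
  case (same_exponent p q k)
  then show ?case by simp
next
  case (less_exponent p q k l)
  show ?case
  proof
    assume e: "2 ^ k * p = 2 ^ l * q"
    have "p = 2 * (2 ^ (l - k - 1) * q)"
      using e unfolding power_of_two_split[OF less_exponent(5)] by simp
    with less_exponent(1) show False by simp
  qed
next
  case (before_powers p k l)
  show ?case
  proof
    assume "2 ^ k * p = 2 ^ l"
    then have "p dvd 2 ^ l" by (metis dvd_triv_right)
    then obtain i where "p = 2 ^ i" using divides_primepow_nat[of 2] two_is_prime_nat by auto
    with before_powers show False by (cases i) auto
  qed
next
  case (powers l k)
  then show ?case by simp
qed

lemma two_power_times_odd:
  assumes "0 < (n::nat)"
  obtains k q where "n = 2 ^ k * q" "odd q"
  using assms
proof (induction n arbitrary: thesis rule: less_induct)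
  case (less n)
  show ?case
  proof (cases "even n")
    case True
    then obtain n' where n': "n = 2 * n'" by (auto elim: evenE)
    then obtain k q where "n' = 2 ^ k * q" "odd q" using less.IH[of n'] less.prems by auto
    then show ?thesis using less.prems(1)[of "Suc k" q] n' by simp
  next
    case False
    then show ?thesis using less.prems(1)[of 0 n] by simp
  qed
qed

lemma odd_not_one: "odd (q::nat) \<Longrightarrow> q \<noteq> 1 \<Longrightarrow> 3 \<le> q"
  by (cases "q = 2") (auto intro: ccontr simp: not_le less_Suc_eq numeral_3_eq_3)

lemma three_sharkovsky_first:
  assumes "0 < n" "n \<noteq> 3"
  shows "3 \<prec>\<^sub>S n"
proof -
  obtain k q where n: "n = 2 ^ k * q" "odd q" by (rule two_power_times_odd[OF assms(1)])
  show ?thesis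
  proof (cases "q = 1")
    case True
    then show ?thesis using before_powers[of 3 0 k] n by simp
  next
    case False
    then have q: "3 \<le> q" using odd_not_one n by blast
    show ?thesis
    proof (cases "k = 0")
      case True
      then show ?thesis using same_exponent[of 3 q 0] q n assms by simp
    next
      case False
      then show ?thesis using less_exponent[of 3 q 0 k] q n by simp
    qed
  qed
qed

section \<open>Truncated tent maps\<close>

text \<open>The tent is spread over \<open>{a..b}\<close> directly: both ends go to \<open>a\<close> and the midpoint to \<open>b\<close>.\<close>

definition tent :: "real \<Rightarrow> real \<Rightarrow> real \<Rightarrow> real" where
  "tent a b x = b - \<bar>2 * x - (a + b)\<bar>"

definition truncate :: "real \<Rightarrow> (real \<Rightarrow> real) \<Rightarrow> real \<Rightarrow> real" where
  "truncate h f x = min h (f x)"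

text \<open>Cycles are represented by their largest points, which makes them comparable by height.\<close>

definition peak :: "real set \<Rightarrow> (real \<Rightarrow> real) \<Rightarrow> nat \<Rightarrow> real \<Rightarrow> bool" where
  "peak I f n x \<longleftrightarrow> period_point I f n x \<and> (\<forall>j. (f ^^ j) x \<le> x)"

lemma continuous_self_map_truncate:
  assumes "continuous_self_map {a..b} f" "h \<in> {a..b}"
  shows "continuous_self_map {a..b} (truncate h f)"
  using assms unfolding continuous_self_map_def truncate_def[abs_def]
  by (auto intro!: continuous_intros simp: image_subset_iff intro: min.coboundedI2)

lemma period_point_peak:
  assumes maps: "f ` I \<subseteq> I" and P: "period_point I f n x"
  obtains j where "peak I f n ((f ^^ j) x)"
proof -
  define Orb where "Orb = range (\<lambda>j. (f ^^ j) x)"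
  have fin: "finite Orb" and ne: "Orb \<noteq> {}"
    using finite_orbit[OF P] by (auto simp: Orb_def)
  obtain j where j: "Max Orb = (f ^^ j) x" using Max_in[OF fin ne] by (auto simp: Orb_def)
  have "(f ^^ i) ((f ^^ j) x) \<le> (f ^^ j) x" for i
  proof -
    have "(f ^^ i) ((f ^^ j) x) \<in> Orb" unfolding Orb_def by (metis comp_apply funpow_add rangeI)
    then show ?thesis using fin j by (metis Max_ge)
  qed
  then have "peak I f n ((f ^^ j) x)"
    using period_point_funpow[OF P maps] by (simp add: peak_def)
  then show ?thesis by (rule that)
qed

lemma period_point_cong:
  "(\<And>j. (g ^^ j) x = (f ^^ j) x) \<Longrightarrow> period_point I g n x \<longleftrightarrow> period_point I f n x"
  by (simp add: period_point_def)

lemma peak_truncate: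
  assumes "peak I f n x" "x \<le> h"
  shows "period_point I (truncate h f) n x"
proof -
  have "(truncate h f ^^ j) x = (f ^^ j) x" for j
  proof (induction j)
    case (Suc j)
    have "(f ^^ Suc j) x \<le> h" using assms order_trans unfolding peak_def by blast
    then show ?case using Suc by (simp add: truncate_def)
  qed simp
  from period_point_cong[OF this, of I n] show ?thesis using assms by (simp add: peak_def)
qed

text \<open>The peak of a cycle of the truncated map is at most \<open>h\<close>. If it is smaller, the cut is never met along
  the cycle, which is then a cycle of \<open>f\<close>.\<close>

lemma period_point_truncate:
  assumes maps: "truncate h f ` I \<subseteq> I" and P: "period_point I (truncate h f) n x"
  shows "period_point I (truncate h f) n h \<or> (\<exists>y<h. peak I f n y)"
proof -
  obtain j where "peak I (truncate h f) n ((truncate h f ^^ j) x)"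
    by (rule period_point_peak[OF maps P])
  then obtain y where y: "peak I (truncate h f) n y" by blast
  then have Q: "period_point I (truncate h f) n y" and top: "\<And>j. (truncate h f ^^ j) y \<le> y"
    by (auto simp: peak_def)
  obtain n' where n': "n = Suc n'" using Q by (cases n) (auto simp: period_point_def)
  have "(truncate h f ^^ n) y = y" using Q by (simp add: period_point_def)
  then have "y = min h (f ((truncate h f ^^ n') y))" by (simp add: n' truncate_def)
  then have "y \<le> h" by (metis min.cobounded1)
  show ?thesis
  proof (cases "y = h")
    case True
    then show ?thesis using Q by simp
  next
    case False
    then have "y < h" using \<open>y \<le> h\<close> by simp
    have eq: "(truncate h f ^^ j) y = (f ^^ j) y" for j
    proof (induction j)
      case (Suc j)
      have "truncate h f ((truncate h f ^^ j) y) < h"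
        using top[of "Suc j"] \<open>y < h\<close> by simp
      then show ?case using Suc by (auto simp: truncate_def min_def split: if_splits)
    qed simp
    then have "peak I f n y"
      using top Q period_point_cong[OF eq, of I n] by (simp add: peak_def)
    with \<open>y < h\<close> show ?thesis by blast
  qed
qed

text \<open>Cut \<open>f\<close> at \<open>x\<close>. The cycle of period \<open>m\<close> survives and forces one of period \<open>n\<close>, which avoids \<open>x\<close>
  because \<open>x\<close> has another period; so it is a cycle of \<open>f\<close> lying below \<open>x\<close>.\<close>

lemma peak_decreasing:
  assumes csm: "continuous_self_map {a..b} f" and pk: "peak {a..b} f m x" and mn: "m \<prec>\<^sub>S n"
  shows "\<exists>y<x. peak {a..b} f n y"
proof -
  have csm': "continuous_self_map {a..b} (truncate x f)"
    using pk by (intro continuous_self_map_truncate csm) (simp add: peak_def period_point_def)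
  have Pm: "period_point {a..b} (truncate x f) m x" using peak_truncate[OF pk] by simp
  obtain y where "period_point {a..b} (truncate x f) n y"
    using sharkovsky_forcing[OF mn csm'] Pm by blast
  from period_point_truncate[OF _ this] csm'
  have "period_point {a..b} (truncate x f) n x \<or> (\<exists>y<x. peak {a..b} f n y)"
    by (simp add: continuous_self_map_def)
  then show ?thesis
    using period_point_unique[OF Pm] sharkovsky_irrefl[OF mn] by blast
qed

lemma continuous_self_map_tent:
  assumes "a \<le> b"
  shows "continuous_self_map {a..b} (tent a b)"
  unfolding continuous_self_map_def tent_def[abs_def]
  using assms by (auto intro!: continuous_intros)

lemma tent_period_three:
  assumes "a < b"
  shows "\<exists>x. period_point {a..b} (tent a b) 3 x"
proof -
  \<comment> \<open>In the unit of one seventh of the interval, the tent permutes 2, 4, 6 cyclically.\<close>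
  define c where "c = (b - a) / 7"
  have c: "0 < c" "b = a + 7 * c" using assms by (auto simp: c_def field_simps)
  have t: "tent a b (a + 2 * c) = a + 4 * c" "tent a b (a + 4 * c) = a + 6 * c"
      "tent a b (a + 6 * c) = a + 2 * c"
    using c by (auto simp: tent_def)
  have "(tent a b ^^ j) (a + 2 * c) \<noteq> a + 2 * c" if "1 \<le> j" "j < 3" for j
  proof -
    have "j = 1 \<or> j = 2" using that by auto
    then show ?thesis using c(1) t by (auto simp: funpow_two)
  qed
  moreover have "(tent a b ^^ 3) (a + 2 * c) = a + 2 * c"
    using t by (simp add: numeral_3_eq_3)
  moreover have "a + 2 * c \<in> {a..b}" using c by simp
  ultimately have "period_point {a..b} (tent a b) 3 (a + 2 * c)"
    by (simp add: period_point_def)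
  then show ?thesis ..
qed

lemma tent_all_periods:
  assumes "a < b" "0 < n"
  shows "\<exists>x. period_point {a..b} (tent a b) n x"
proof (cases "n = 3")
  case True
  then show ?thesis using tent_period_three assms by simp
next
  case False
  show ?thesis
    by (rule sharkovsky_forcing[OF three_sharkovsky_first[OF assms(2) False]
          continuous_self_map_tent[OF less_imp_le[OF assms(1)]] tent_period_three[OF assms(1)]])
qed

text \<open>Only finitely many affine maps describe an iterate, all of them steep; each meets the diagonal at most
  once, so an iterate has finitely many fixed points and a lowest peak of each period exists.\<close>

lemma tent_funpow_affine:
  "\<exists>F. finite F \<and> (\<forall>(s, c)\<in>F. \<bar>s\<bar> = 2 ^ n) \<and> (\<forall>x. \<exists>(s, c)\<in>F. (tent a b ^^ n) x = s * x + c)"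
proof (induction n)
  case 0
  show ?case by (intro exI[of _ "{(1, 0)}"]) auto
next
  case (Suc n)
  then obtain F where F: "finite F" "\<And>s c. (s, c) \<in> F \<Longrightarrow> \<bar>s\<bar> = 2 ^ n"
      "\<And>x. \<exists>s c. (s, c) \<in> F \<and> (tent a b ^^ n) x = s * x + c"
    by fast
  define G where "G = (\<lambda>(s, c). (2 * s, 2 * c - a)) ` F \<union> (\<lambda>(s, c). (- 2 * s, 2 * b + a - 2 * c)) ` F"
  have "\<exists>(s, c)\<in>G. (tent a b ^^ Suc n) x = s * x + c" for x
  proof -
    obtain s c where sc: "(s, c) \<in> F" "(tent a b ^^ n) x = s * x + c" using F(3) by blast
    have inG: "(2 * s, 2 * c - a) \<in> G" "(- 2 * s, 2 * b + a - 2 * c) \<in> G"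
      using sc(1) unfolding G_def by force+
    have "(tent a b ^^ Suc n) x = tent a b (s * x + c)" by (simp add: sc)
    also have "\<dots> = (2 * s) * x + (2 * c - a) \<or> \<dots> = (- 2 * s) * x + (2 * b + a - 2 * c)"
      by (auto simp: tent_def abs_if algebra_simps)
    finally show ?thesis using inG by fastforce
  qed
  moreover have "finite G" using F(1) by (simp add: G_def)
  moreover have "\<forall>(s, c)\<in>G. \<bar>s\<bar> = 2 ^ Suc n"
    using F(2) by (auto simp: G_def abs_mult)
  ultimately show ?case by blast
qed

lemma finite_tent_fixed_points:
  assumes "0 < n"
  shows "finite {x. (tent a b ^^ n) x = x}"
proof -
  obtain F where F: "finite F" "\<And>s c. (s, c) \<in> F \<Longrightarrow> \<bar>s\<bar> = 2 ^ n"
      "\<And>x. \<exists>s c. (s, c) \<in> F \<and> (tent a b ^^ n) x = s * x + c"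
    using tent_funpow_affine[of n a b] by fast
  have "{x. (tent a b ^^ n) x = x} \<subseteq> (\<lambda>(s, c). c / (1 - s)) ` F"
  proof
    fix x assume "x \<in> {x. (tent a b ^^ n) x = x}"
    then obtain s c where sc: "(s, c) \<in> F" "x = s * x + c" using F(3)[of x] by auto
    have "(1::real) < 2 ^ n" using assms by (intro one_less_power) auto
    then have "s \<noteq> 1" using F(2)[OF sc(1)] by auto
    then have "x = c / (1 - s)" using sc(2) by (simp add: field_simps)
    then show "x \<in> (\<lambda>(s, c). c / (1 - s)) ` F" using sc(1) by force
  qed
  then show ?thesis using F(1) finite_surj by blast
qed

lemma lowest_tent_peak:
  assumes "a < b" "0 < n"
  obtains h where "peak {a..b} (tent a b) n h" "\<And>x. peak {a..b} (tent a b) n x \<Longrightarrow> h \<le> x"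
proof -
  define S where "S = {x. peak {a..b} (tent a b) n x}"
  have "S \<subseteq> {x. (tent a b ^^ n) x = x}" by (auto simp: S_def peak_def period_point_def)
  then have fin: "finite S" using finite_tent_fixed_points[OF assms(2)] finite_subset by blast
  obtain y where "period_point {a..b} (tent a b) n y" using tent_all_periods[OF assms] by blast
  then obtain j where "peak {a..b} (tent a b) n ((tent a b ^^ j) y)"
    using period_point_peak continuous_self_map_tent[of a b] assms
    unfolding continuous_self_map_def by (metis less_imp_le)
  then have "S \<noteq> {}" by (auto simp: S_def)
  with fin that[of "Min S"] Min_in[OF fin] show ?thesis by (auto simp: S_def)
qed

text \<open>Cut at the lowest peak \<open>h\<close> of period \<open>n\<close>. A cycle of a period \<open>m\<close> that forces \<open>n\<close> would be a cycle
  of the tent below \<open>h\<close>, and would force a peak of period \<open>n\<close> still lower.\<close>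

theorem sharkovsky_realization:
  fixes a b :: real
  assumes ab: "a < b" and n: "0 < n"
  shows "\<exists>f. continuous_self_map {a..b} f \<and> (\<exists>x. period_point {a..b} f n x)
    \<and> (\<forall>m. m \<prec>\<^sub>S n \<longrightarrow> \<not> (\<exists>x. period_point {a..b} f m x))"
proof -
  have tent: "continuous_self_map {a..b} (tent a b)" using ab by (simp add: continuous_self_map_tent)
  obtain h where h: "peak {a..b} (tent a b) n h" "\<And>x. peak {a..b} (tent a b) n x \<Longrightarrow> h \<le> x"
    by (rule lowest_tent_peak[OF ab n]) blast
  define f where "f = truncate h (tent a b)"
  have csm: "continuous_self_map {a..b} f" unfolding f_def
    using h(1) by (intro continuous_self_map_truncate tent) (simp add: peak_def period_point_def)
  have Pn: "period_point {a..b} f n h" unfolding f_def using peak_truncate[OF h(1)] by simp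
  have "\<not> period_point {a..b} f m x" if mn: "m \<prec>\<^sub>S n" for m x
  proof
    assume "period_point {a..b} f m x"
    then have "period_point {a..b} f m h \<or> (\<exists>y<h. peak {a..b} (tent a b) m y)"
      using period_point_truncate csm unfolding f_def continuous_self_map_def by blast
    then obtain y where y: "y < h" "peak {a..b} (tent a b) m y"
      using period_point_unique[OF Pn] sharkovsky_irrefl[OF mn] by blast
    from peak_decreasing[OF tent y(2) mn] h(2) y(1) show False by force
  qed
  with csm Pn show ?thesis by blast
qed

text \<open>Cut at the supremum \<open>h\<close> of the lowest peaks of the powers of two. A period \<open>m\<close> that is not a power of
  two cannot occur below \<open>h\<close>, as some power of two would then have a peak lower than its lowest one. So every
  such cycle passes through \<open>h\<close>; but then \<open>2 * m\<close>, which \<open>m\<close> forces, is another period of this kind, and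
  \<open>h\<close> would have two periods.\<close>

theorem all_powers_of_two_only:
  fixes a b :: real
  assumes ab: "a < b"
  shows "\<exists>f. continuous_self_map {a..b} f \<and> (\<forall>i. \<exists>x. period_point {a..b} f (2 ^ i) x)
    \<and> (\<forall>m. (\<exists>x. period_point {a..b} f m x) \<longrightarrow> (\<exists>i. m = 2 ^ i))"
proof -
  have tent: "continuous_self_map {a..b} (tent a b)" using ab by (simp add: continuous_self_map_tent)
  have "\<exists>h. peak {a..b} (tent a b) (2 ^ i) h \<and> (\<forall>x. peak {a..b} (tent a b) (2 ^ i) x \<longrightarrow> h \<le> x)" for i
    by (rule lowest_tent_peak[OF ab, of "2 ^ i"]) auto
  then obtain H where H: "\<And>i. peak {a..b} (tent a b) (2 ^ i) (H i)"
      and low: "\<And>i x. peak {a..b} (tent a b) (2 ^ i) x \<Longrightarrow> H i \<le> x"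
    by metis
  have HI: "H i \<in> {a..b}" for i using H[of i] by (simp add: peak_def period_point_def)
  define h where "h = (SUP i. H i)"
  have bdd: "bdd_above (range H)" using HI by (intro bdd_aboveI[of _ b]) auto
  have Hh: "H i \<le> h" for i unfolding h_def by (rule cSUP_upper[OF _ bdd]) simp
  have "h \<in> {a..b}"
  proof -
    have "a \<le> h" using HI[of 0] Hh[of 0] by simp
    moreover have "h \<le> b" unfolding h_def using HI by (intro cSUP_least) auto
    ultimately show ?thesis by simp
  qed
  define f where "f = truncate h (tent a b)"
  have csm: "continuous_self_map {a..b} f" unfolding f_def
    by (intro continuous_self_map_truncate tent \<open>h \<in> {a..b}\<close>)
  have pow: "\<exists>x. period_point {a..b} f (2 ^ i) x" for i
    unfolding f_def using peak_truncate[OF H Hh] by blast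
  have no_low: "\<not> peak {a..b} (tent a b) m y" if "y < h" and mi: "\<And>i. m \<prec>\<^sub>S 2 ^ i" for m y
  proof
    assume pk: "peak {a..b} (tent a b) m y"
    obtain i where "y < H i" using \<open>y < h\<close> less_cSUP_iff[OF _ bdd] unfolding h_def by auto
    with peak_decreasing[OF tent pk mi[of i]] low[of i] show False by force
  qed
  have "\<exists>i. m = 2 ^ i" if P: "period_point {a..b} f m x" for m x
  proof (rule ccontr)
    assume not_pow: "\<nexists>i. m = 2 ^ i"
    obtain k q where kq: "m = 2 ^ k * q" "odd q"
      using two_power_times_odd[of m] P by (auto simp: period_point_def)
    have q: "3 \<le> q" using not_pow kq by (intro odd_not_one) auto
    have m_h: "period_point {a..b} f m' h" if "period_point {a..b} f m' y" "m' = 2 ^ k' * q" for m' k' y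
        proof -
      have "period_point {a..b} f m' h \<or> (\<exists>t<h. peak {a..b} (tent a b) m' t)"
        using csm that(1) unfolding f_def continuous_self_map_def
        by (intro period_point_truncate) auto
      moreover have "m' \<prec>\<^sub>S 2 ^ i" for i
        unfolding that(2) by (rule before_powers[OF kq(2) q])
      ultimately show ?thesis using no_low by blast
    qed
    have mm: "m \<prec>\<^sub>S 2 ^ Suc k * q" using less_exponent[of q q k "Suc k"] kq q by simp
    then obtain y where "period_point {a..b} f (2 ^ Suc k * q) y"
      using sharkovsky_forcing[OF mm csm] P by blast
    from period_point_unique[OF m_h[OF P kq(1)] m_h[OF this refl]] sharkovsky_irrefl[OF mm]
    show False by contradiction
  qed
  with csm pow show ?thesis by blast
qed

theorem theorem4:
  fixes a b :: real and I :: "real set"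
  assumes "a < b" and "I = {a..b}"
  shows "(\<forall>f m n. continuous_self_map I f \<and> (\<exists>x. period_point I f m x) \<and> m \<prec>\<^sub>S n
            \<longrightarrow> (\<exists>x. period_point I f n x))
       \<and> (\<forall>n::nat. 0 < n \<longrightarrow> (\<exists>f. continuous_self_map I f \<and> (\<exists>x. period_point I f n x)
            \<and> (\<forall>m. m \<prec>\<^sub>S n \<longrightarrow> \<not> (\<exists>x. period_point I f m x))))
       \<and> (\<exists>f. continuous_self_map I f \<and> (\<forall>i. \<exists>x. period_point I f (2 ^ i) x)
            \<and> (\<forall>m. (\<exists>x. period_point I f m x) \<longrightarrow> (\<exists>i. m = 2 ^ i)))"
  unfolding assms(2)
proof (intro conjI allI impI)
  fix f m n
  assume "continuous_self_map {a..b} f \<and> (\<exists>x. period_point {a..b} f m x) \<and> m \<prec>\<^sub>S n"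
  then show "\<exists>x. period_point {a..b} f n x" by (blast intro: sharkovsky_forcing)
qed (use assms(1) sharkovsky_realization all_powers_of_two_only in auto)

end
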